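(* Let $\Omega=(0,1)^3$, let $\epsilon>0$, and assume the convection vector $\mathbf{w}=(w_1,w_2,w_3)$ has separable components $w_\ell(x,y,z)=\phi_\ell(x)\psi_\ell(y)\upsilon_\ell(z)$, $\ell=1,2,3$, with $\phi_\ell,\psi_\ell,\upsilon_\ell:[0,1]\to\mathbb{R}$. Let $(x_i,y_j,z_k)$, $i,j,k=0,\dots,n$, be the uniform grid nodes discretizing $\bar\Omega$ with mesh size $h$, and set $\Phi_\ell=\mathrm{diag}(\phi_\ell(x_0),\dots,\phi_\ell(x_n))$, $\Psi_\ell=\mathrm{diag}(\psi_\ell(y_0),\dots,\psi_\ell(y_n))$, $\Upsilon_\ell=\mathrm{diag}(\upsilon_\ell(z_0),\dots,\upsilon_\ell(z_n))$, $\ell=1,2,3$. Let $T,B\in\mathbb{R}^{(n+1)\times(n+1)}$ be the one-dimensional second- and first-order centered difference matrices defined in the context, and $I$ the $(n+1)\times(n+1)$ identity. Then the centered finite-difference discretization of the differential operator $u\mapsto-\epsilon\Delta u+\mathbf{w}\cdot\nabla u$ is given by the linear matrix operator $$\mathcal{L}_h:\ \mathcal{U}\mapsto \epsilon(I\otimes T)\,\mathcal{U}+\epsilon\,\mathcal{U}T+\epsilon(T\otimes I)\,\mathcal{U}+(\Upsilon_1\otimes\Phi_1B)\,\mathcal{U}\,\Psi_1+(\Upsilon_2\otimes\Phi_2)\,\mathcal{U}\,B^T\Psi_2+[(\Upsilon_3B)\otimes\Phi_3]\,\mathcal{U}\,\Psi_3$$ acting on $\mathcal{U}=\sum_{k=0}^n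 e_{k+1}\otimes U^{(k)}\in\mathbb{R}^{(n+1)^2\times(n+1)}$; that is, for all $U^{(0)},\dots,U^{(n)}\in\mathbb{R}^{(n+1)\times(n+1)}$, writing $\mathcal{L}_h(\mathcal{U})=\sum_{k=0}^n e_{k+1}\otimes L^{(k)}$ with $L^{(k)}\in\mathbb{R}^{(n+1)\times(n+1)}$, for every interior node, $1\le i,j,k\le n-1$, $$\begin{aligned}L^{(k)}_{i,j}=&-\frac{\epsilon}{h^2}\Big[\big(U^{(k)}_{i-1,j}-2U^{(k)}_{i,j}+U^{(k)}_{i+1,j}\big)+\big(U^{(k)}_{i,j-1}-2U^{(k)}_{i,j}+U^{(k)}_{i,j+1}\big)+\big(U^{(k-1)}_{i,j}-2U^{(k)}_{i,j}+U^{(k+1)}_{i,j}\big)\Big]\\&+w_1(x_i,y_j,z_k)\frac{U^{(k)}_{i+1,j}-U^{(k)}_{i-1,j}}{2h}+w_2(x_i,y_j,z_k)\frac{U^{(k)}_{i,j+1}-U^{(k)}_{i,j-1}}{2h}+w_3(x_i,y_j,z_k)\frac{U^{(k+1)}_{i,j}-U^{(k-1)}_{i,j}}{2h}.\end{aligned}$$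
   Context: Here $n\ge 2$, $h=1/n$, $x_i=ih$, $y_j=jh$, $z_k=kh$. Matrices in $\mathbb{R}^{(n+1)\times(n+1)}$ have rows and columns indexed by $0,\dots,n$. $U^{(k)}_{i,j}$ denotes the grid value at node $(x_i,y_j,z_k)$, and $e_1,\dots,e_{n+1}$ are the canonical basis vectors of $\mathbb{R}^{n+1}$, so $\mathcal{U}=\sum_{k=0}^n e_{k+1}\otimes U^{(k)}$ is the tall block matrix obtained by stacking $U^{(0)},\dots,U^{(n)}$ vertically. $\otimes$ is the Kronecker product ($A\otimes C$ is the block matrix with blocks $a_{pq}C$). The centered finite-difference discretization of $-\epsilon\Delta u+\mathbf{w}\cdot\nabla u$ at an interior node is obtained by replacing the second derivatives with three-point second differences and the first derivatives with centered first differences of the grid values (this gives the right-hand side of the displayed identity). The matrices $T$ and $B$ are tridiagonal. $T$ has entries $T_{i,i}=2/h^2$ for $1\le i\le n-1$ and $T_{i,i+1}=T_{i+1,i}=-1/h^2$ for $0\le i\le n-1$; the corner entries $T_{0,0}$ and $T_{n,n}$ are unspecified (arbitrary, to be fixed by the boundary conditions). $B$ has, in each row $1\le i\le n-1$, $B_{i,i-1}=-1/(2h)$, $B_{i,i}=0$, $B_{i,i+1}=1/(2h)$; its nonzero entries in rows $0$ and $n$, namely $B_{0,0},B_{0,1},B_{n,n-1},B_{n,n}$, are unspecified (arbitrary, to be fixed by the boundary conditions). *)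

theory Defs
  imports Complex_Main "Jordan_Normal_Form.Matrix"
begin

definition kronecker :: "'a::times mat \<Rightarrow> 'a mat \<Rightarrow> 'a mat"  (infixl "\<otimes>\<^sub>K" 70) where
  "A \<otimes>\<^sub>K C = mat (dim_row A * dim_row C) (dim_col A * dim_col C)
     (\<lambda>(r, s). A $$ (r div dim_row C, s div dim_col C) * C $$ (r mod dim_row C, s mod dim_col C))"

lemma dim_kronecker [simp]:
  "dim_row (A \<otimes>\<^sub>K C) = dim_row A * dim_row C"
  "dim_col (A \<otimes>\<^sub>K C) = dim_col A * dim_col C"
  by (simp_all add: kronecker_def)

lemma kronecker_block:
  assumes "p < dim_row A" "q < dim_col A" "i < dim_row C" "j < dim_col C"
  shows "(A \<otimes>\<^sub>K C) $$ (p * dim_row C + i, q * dim_col C + j) = A $$ (p, q) * C $$ (i, j)"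
proof -
  have *: "p * m + i < a * m" if "p < a" "i < m" for p m i a :: nat
  proof -
    have "p * m + i < Suc p * m" using that by simp
    also have "\<dots> \<le> a * m" using that by (intro mult_le_mono1) simp
    finally show ?thesis .
  qed
  show ?thesis using assms *[of p "dim_row A" i "dim_row C"] *[of q "dim_col A" j "dim_col C"]
    by (simp add: kronecker_def)
qed

text \<open>The canonical basis vector $e_{k+1}$ of $R^m$ as an $m \times 1$ matrix. Basis vectors are
  numbered from 1, while indices of \<^const>\<open>unit_vec\<close> start at 0.\<close>

definition basis_col :: "nat \<Rightarrow> nat \<Rightarrow> real mat" where
  "basis_col m k = mat_of_cols m [unit_vec m k]"

text \<open>The tall matrix $\sum_{k=0}^n e_{k+1} \otimes U^{(k)}$. A finite sum of matrices of
  prescribed size is a \<^const>\<open>finsum\<close> in the corresponding module.\<close>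

definition stack :: "nat \<Rightarrow> (nat \<Rightarrow> real mat) \<Rightarrow> real mat" where
  "stack n U = finsum (module_mat TYPE(real) ((n + 1)^2) (n + 1))
     (\<lambda>k. basis_col (n + 1) k \<otimes>\<^sub>K U k) {0..n}"

definition tridiagonal :: "'a::zero mat \<Rightarrow> bool" where
  "tridiagonal A \<longleftrightarrow>
     (\<forall>i < dim_row A. \<forall>j < dim_col A. j + 1 < i \<or> i + 1 < j \<longrightarrow> A $$ (i, j) = 0)"

text \<open>The entries left open in the two definitions below are the ones that depend on the
  boundary conditions: the corners of $T$, and the entries of $B$ at $(0,0)$, $(0,1)$, $(n,n-1)$,
  $(n,n)$. This is why these are predicates and not matrices.\<close>

definition second_difference_mat :: "nat \<Rightarrow> real \<Rightarrow> real mat \<Rightarrow> bool" where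
  "second_difference_mat n h T \<longleftrightarrow>
     T \<in> carrier_mat (n + 1) (n + 1) \<and> tridiagonal T \<and>
     (\<forall>i\<in>{1..n - 1}. T $$ (i, i) = 2 / h^2) \<and>
     (\<forall>i\<in>{0..n - 1}. T $$ (i, i + 1) = - 1 / h^2 \<and> T $$ (i + 1, i) = - 1 / h^2)"

definition first_difference_mat :: "nat \<Rightarrow> real \<Rightarrow> real mat \<Rightarrow> bool" where
  "first_difference_mat n h B \<longleftrightarrow>
     B \<in> carrier_mat (n + 1) (n + 1) \<and> tridiagonal B \<and>
     (\<forall>i\<in>{1..n - 1}. B $$ (i, i - 1) = - 1 / (2 * h) \<and> B $$ (i, i) = 0 \<and>
        B $$ (i, i + 1) = 1 / (2 * h))"

definition conv_diff_op ::
  "nat \<Rightarrow> real \<Rightarrow> real mat \<Rightarrow> real mat \<Rightarrow> (nat \<Rightarrow> real mat) \<Rightarrow> (nat \<Rightarrow> real mat) \<Rightarrow> (nat \<Rightarrow> real mat) \<Rightarrow>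
   real mat \<Rightarrow> real mat" where
  "conv_diff_op n \<epsilon> T B \<Phi> \<Psi> \<Upsilon> X =
       \<epsilon> \<cdot>\<^sub>m ((1\<^sub>m (n + 1) \<otimes>\<^sub>K T) * X)
     + \<epsilon> \<cdot>\<^sub>m (X * T)
     + \<epsilon> \<cdot>\<^sub>m ((T \<otimes>\<^sub>K 1\<^sub>m (n + 1)) * X)
     + (\<Upsilon> 1 \<otimes>\<^sub>K (\<Phi> 1 * B)) * X * \<Psi> 1
     + (\<Upsilon> 2 \<otimes>\<^sub>K \<Phi> 2) * X * transpose_mat B * \<Psi> 2
     + ((\<Upsilon> 3 * B) \<otimes>\<^sub>K \<Phi> 3) * X * \<Psi> 3"

end

theory Submission
  imports Defs
begin

text \<open>
  In the stacked matrix, row \<open>k * (n + 1) + i\<close> and column \<open>j\<close> hold the value at the node with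
  indices \<open>(i, j, k)\<close>. A Kronecker product acting from the left therefore works separately on the
  two row indices: its first factor combines the values along \<open>z\<close>, its second factor along \<open>x\<close>,
  while a factor on the right of the stacked matrix combines the values along \<open>y\<close>. This is
  \<open>kronecker_mult_index\<close>, and together with \<open>stack_index\<close> it turns every entry of each of the six
  terms into iterated one-dimensional sums of grid values.

  At an interior index a row of \<open>T\<close> or \<open>B\<close> has at most three nonzero entries, so those sums
  collapse to the three-point second difference and the centered first difference
  (\<open>second_difference_row\<close>, \<open>first_difference_row\<close>). The entries left to the boundary conditions
  lie in the rows \<open>0\<close> and \<open>n\<close>, which these sums never meet. Along \<open>y\<close> the
  columns of the right factor matter: \<open>T\<close> enters as it is because it is symmetric whatever its
  corners are, while \<open>B\<close> has to be transposed. Diagonal factors only multiply by a nodal value, and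
  for \<open>l = 1, 2, 3\<close> the three diagonal factors of the \<open>l\<close>-th convection term multiply up to the
  separable coefficient \<open>w l\<close> at the node.
\<close>

section \<open>Block indices and stacked matrices\<close>

lemma block_row_less: "k * p + i < m * p" if "k < m" "i < p" for k p i m :: nat
proof -
  have "k * p + i < Suc k * p" using that by simp
  also have "\<dots> \<le> m * p" using that by (intro mult_le_mono1) simp
  finally show ?thesis .
qed

lemma sum_blocks: "(\<Sum>s<m * p. g s) = (\<Sum>q<m. \<Sum>r<p. g (q * p + r))"
  for g :: "nat \<Rightarrow> 'a::comm_monoid_add"
proof -
  have "(\<Sum>s<m * p. g s) = (\<Sum>q<m. sum g {q * p..<q * p + p})"
    by (rule sum.nat_group[symmetric])
  also have "\<dots> = (\<Sum>q<m. \<Sum>r<p. g (q * p + r))"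
  proof (rule sum.cong[OF refl])
    fix q
    show "sum g {q * p..<q * p + p} = (\<Sum>r<p. g (q * p + r))"
      using sum.shift_bounds_nat_ivl[of g 0 "q * p" p]
      by (simp add: atLeast0LessThan add.commute)
  qed
  finally show ?thesis .
qed

lemma mult_mat_index_sum:
  assumes "A \<in> carrier_mat m c" "X \<in> carrier_mat c d" "i < m" "j < d"
  shows "(A * X) $$ (i, j) = (\<Sum>q<c. A $$ (i, q) * X $$ (q, j))"
  using assms by (simp add: scalar_prod_def atLeast0LessThan)

text \<open>
  The two levels of the sum are the two levels of the row index of \<open>X\<close>: the inner one runs inside a
  block, the outer one over the blocks. Keeping them nested lets each factor be evaluated on its own.
\<close>

lemma kronecker_mult_index:
  fixes X :: "'a::comm_semiring_0 mat"
  assumes A: "A \<in> carrier_mat m m" and C: "C \<in> carrier_mat p p"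
    and X: "X \<in> carrier_mat (m * p) d"
    and k: "k < m" and i: "i < p" and j: "j < d"
  shows "((A \<otimes>\<^sub>K C) * X) $$ (k * p + i, j)
    = (\<Sum>q<m. A $$ (k, q) * (\<Sum>r<p. C $$ (i, r) * X $$ (q * p + r, j)))"
proof -
  have AC: "A \<otimes>\<^sub>K C \<in> carrier_mat (m * p) (m * p)"
    using A C by (intro carrier_matI) auto
  have "((A \<otimes>\<^sub>K C) * X) $$ (k * p + i, j)
      = (\<Sum>q<m. \<Sum>r<p. (A \<otimes>\<^sub>K C) $$ (k * p + i, q * p + r) * X $$ (q * p + r, j))"
    unfolding mult_mat_index_sum[OF AC X block_row_less[OF k i] j] by (rule sum_blocks)
  also have "\<dots> = (\<Sum>q<m. \<Sum>r<p. A $$ (k, q) * (C $$ (i, r) * X $$ (q * p + r, j)))"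
  proof (intro sum.cong refl)
    fix q r assume "q \<in> {..<m}" "r \<in> {..<p}"
    then have "(A \<otimes>\<^sub>K C) $$ (k * p + i, q * p + r) = A $$ (k, q) * C $$ (i, r)"
      using kronecker_block[of k A q i C r] A C k i by auto
    then show "(A \<otimes>\<^sub>K C) $$ (k * p + i, q * p + r) * X $$ (q * p + r, j)
        = A $$ (k, q) * (C $$ (i, r) * X $$ (q * p + r, j))"
      by (simp add: mult.assoc)
  qed
  finally show ?thesis by (simp add: sum_distrib_left)
qed

text \<open>
  Membership in the carrier and the entries are proved in one induction, because the entries of the
  sum of two matrices are only known once the dimensions of the second one are.
\<close>

lemma finsum_mat_carrier_index:
  fixes F :: "'b \<Rightarrow> 'a::comm_ring_1 mat"
  assumes "finite S" and "\<And>s. s \<in> S \<Longrightarrow> F s \<in> carrier_mat nr nc"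
  shows "finsum (module_mat TYPE('a) nr nc) F S \<in> carrier_mat nr nc \<and>
    (\<forall>i<nr. \<forall>j<nc. finsum (module_mat TYPE('a) nr nc) F S $$ (i, j) = (\<Sum>s\<in>S. F s $$ (i, j)))"
  using assms
proof (induction S rule: finite_induct)
  case empty
  interpret abelian_group "module_mat TYPE('a) nr nc" by (rule abelian_group_mat)
  show ?case by (simp add: module_mat_simps)
next
  case (insert s S)
  interpret abelian_group "module_mat TYPE('a) nr nc" by (rule abelian_group_mat)
  have IH: "finsum (module_mat TYPE('a) nr nc) F S \<in> carrier_mat nr nc"
    "\<forall>i<nr. \<forall>j<nc. finsum (module_mat TYPE('a) nr nc) F S $$ (i, j) = (\<Sum>s\<in>S. F s $$ (i, j))"
    using insert by auto
  have Fs: "F s \<in> carrier_mat nr nc" using insert.prems by simp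
  have eq: "finsum (module_mat TYPE('a) nr nc) F (insert s S)
      = F s + finsum (module_mat TYPE('a) nr nc) F S"
    using insert by (subst finsum_insert) (auto simp: module_mat_simps)
  show ?case unfolding eq using IH Fs insert.hyps by auto
qed

lemma
  assumes U: "\<And>k. k \<le> n \<Longrightarrow> U k \<in> carrier_mat (n + 1) (n + 1)"
  shows stack_carrier: "stack n U \<in> carrier_mat ((n + 1) * (n + 1)) (n + 1)"
    and stack_index: "\<lbrakk>k \<le> n; i \<le> n; j \<le> n\<rbrakk> \<Longrightarrow> stack n U $$ (k * (n + 1) + i, j) = U k $$ (i, j)"
proof -
  have e: "basis_col (n + 1) k \<in> carrier_mat (n + 1) 1" for k
    by (simp add: basis_col_def mat_of_cols_def)
  have carr: "basis_col (n + 1) k \<otimes>\<^sub>K U k \<in> carrier_mat ((n + 1)^2) (n + 1)" if "k \<in> {0..n}" for k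
    using U[of k] e[of k] that by (intro carrier_matI) (auto simp: power2_eq_square)
  have fs: "stack n U \<in> carrier_mat ((n + 1)^2) (n + 1) \<and> (\<forall>i<(n + 1)^2. \<forall>j<n + 1.
      stack n U $$ (i, j) = (\<Sum>k\<in>{0..n}. (basis_col (n + 1) k \<otimes>\<^sub>K U k) $$ (i, j)))"
    unfolding stack_def by (rule finsum_mat_carrier_index[OF finite_atLeastAtMost carr])
  then show "stack n U \<in> carrier_mat ((n + 1) * (n + 1)) (n + 1)"
    unfolding power2_eq_square by blast
  assume k: "k \<le> n" and i: "i \<le> n" and j: "j \<le> n"
  have "k * (n + 1) + i < (n + 1)^2"
    unfolding power2_eq_square by (rule block_row_less) (use k i in auto)
  then have "stack n U $$ (k * (n + 1) + i, j)
      = (\<Sum>l\<in>{0..n}. (basis_col (n + 1) l \<otimes>\<^sub>K U l) $$ (k * (n + 1) + i, j))"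
    using conjunct2[OF fs] less_Suc_eq_le[of j n] j unfolding Suc_eq_plus1 by blast
  also have "\<dots> = (\<Sum>l\<in>{0..n}. if l = k then U l $$ (i, j) else 0)"
  proof (intro sum.cong refl)
    fix l assume l: "l \<in> {0..n}"
    have "(basis_col (n + 1) l \<otimes>\<^sub>K U l) $$ (k * (n + 1) + i, 0 * (n + 1) + j)
        = basis_col (n + 1) l $$ (k, 0) * U l $$ (i, j)"
      using kronecker_block[of k "basis_col (n + 1) l" 0 i "U l" j] e[of l] U[of l] k i j l by auto
    moreover have "basis_col (n + 1) l $$ (k, 0) = (if l = k then 1 else 0)"
      using k l by (simp add: basis_col_def mat_of_cols_index unit_vec_def)
    ultimately show "(basis_col (n + 1) l \<otimes>\<^sub>K U l) $$ (k * (n + 1) + i, j)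
        = (if l = k then U l $$ (i, j) else 0)"
      by simp
  qed
  also have "\<dots> = U k $$ (i, j)" using k by simp
  finally show "stack n U $$ (k * (n + 1) + i, j) = U k $$ (i, j)" .
qed

text \<open>
  Cutting a matrix into consecutive blocks of \<open>n + 1\<close> rows inverts stacking, so the value of the
  operator always decomposes into layers.
\<close>

lemma stack_surj:
  assumes X: "X \<in> carrier_mat ((n + 1) * (n + 1)) (n + 1)"
  shows "\<exists>L. (\<forall>k\<in>{0..n}. L k \<in> carrier_mat (n + 1) (n + 1)) \<and> X = stack n L"
proof -
  define L where "L k = mat (n + 1) (n + 1) (\<lambda>(i, j). X $$ (k * (n + 1) + i, j))" for k
  have L: "L k \<in> carrier_mat (n + 1) (n + 1)" for k by (simp add: L_def)
  have SL: "stack n L \<in> carrier_mat ((n + 1) * (n + 1)) (n + 1)"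
    by (rule stack_carrier[OF L])
  have "X = stack n L"
  proof (rule eq_matI)
    fix s j assume "s < dim_row (stack n L)" "j < dim_col (stack n L)"
    then have s: "s < (n + 1) * (n + 1)" and j: "j < n + 1"
      by (simp_all only: carrier_matD[OF SL])
    define k i where "k = s div (n + 1)" and "i = s mod (n + 1)"
    have ki: "s = k * (n + 1) + i" unfolding k_def i_def by (rule div_mult_mod_eq[symmetric])
    have "k < n + 1" unfolding k_def by (rule less_mult_imp_div_less[OF s])
    moreover have "i < n + 1" unfolding i_def by (rule mod_less_divisor) simp
    ultimately have le: "k \<le> n" "i \<le> n" "j \<le> n" using j by simp_all
    have "stack n L $$ (s, j) = L k $$ (i, j)"
      unfolding ki by (rule stack_index[OF L le])
    also have "\<dots> = X $$ (s, j)"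
      unfolding ki L_def using \<open>i < n + 1\<close> j by simp
    finally show "X $$ (s, j) = stack n L $$ (s, j)" by (rule sym)
  qed (simp_all only: carrier_matD[OF SL] carrier_matD[OF X])
  with L show ?thesis by (intro exI[of _ L]) simp
qed

section \<open>Difference stencils\<close>

text \<open>
  The restriction to \<open>1 \<le> i \<le> n - 1\<close> keeps both neighbours of \<open>i\<close> inside the index range, and it
  excludes truncation in \<open>i - 1\<close>.
\<close>

lemma tridiagonal_sum:
  fixes A :: "real mat"
  assumes A: "A \<in> carrier_mat (n + 1) (n + 1)" and tri: "tridiagonal A"
    and i: "i \<in> {1..n - 1}"
  shows "(\<Sum>q<n + 1. A $$ (i, q) * f q)
    = A $$ (i, i - 1) * f (i - 1) + A $$ (i, i) * f i + A $$ (i, i + 1) * f (i + 1)"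
proof -
  have "(\<Sum>q<n + 1. A $$ (i, q) * f q) = (\<Sum>q\<in>{i - 1, i, i + 1}. A $$ (i, q) * f q)"
  proof (rule sum.mono_neutral_right)
    show "\<forall>q\<in>{..<n + 1} - {i - 1, i, i + 1}. A $$ (i, q) * f q = 0"
    proof
      fix q assume q: "q \<in> {..<n + 1} - {i - 1, i, i + 1}"
      then have "q + 1 < i \<or> i + 1 < q" by auto
      then have "A $$ (i, q) = 0" using tri A q i unfolding tridiagonal_def by auto
      then show "A $$ (i, q) * f q = 0" by simp
    qed
  qed (use i in auto)
  moreover have "i - 1 \<noteq> i" using i by auto
  ultimately show ?thesis by simp
qed

lemma second_difference_row:
  assumes T: "second_difference_mat n h T" and i: "i \<in> {1..n - 1}"
  shows "(\<Sum>q<n + 1. T $$ (i, q) * f q) = - (f (i - 1) - 2 * f i + f (i + 1)) / h^2"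
proof -
  have TC: "T \<in> carrier_mat (n + 1) (n + 1)" and tri: "tridiagonal T"
    and d: "T $$ (i, i) = 2 / h^2" and u: "T $$ (i, i + 1) = - 1 / h^2"
    using T i by (auto simp: second_difference_mat_def)
  \<comment> \<open>The lower off-diagonal is prescribed from the row above, hence the shift by one.\<close>
  have "i - 1 \<in> {0..n - 1}" "i - 1 + 1 = i" using i by auto
  then have l: "T $$ (i, i - 1) = - 1 / h^2"
    using T unfolding second_difference_mat_def by metis
  show ?thesis
    unfolding tridiagonal_sum[OF TC tri i] d u l by (simp add: algebra_simps add_divide_distrib diff_divide_distrib)
qed

text \<open>
  The corner entries may be arbitrary, but they lie on the diagonal. Symmetry is what lets the factor
  \<open>T\<close> on the right of the stacked matrix be evaluated by its rows.
\<close>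

lemma second_difference_symmetric:
  assumes T: "second_difference_mat n h T" and "i \<le> n" "q \<le> n"
  shows "T $$ (i, q) = T $$ (q, i)"
proof -
  have TC: "T \<in> carrier_mat (n + 1) (n + 1)" and tri: "tridiagonal T"
    and off: "\<And>i. i \<in> {0..n - 1} \<Longrightarrow> T $$ (i, i + 1) = T $$ (i + 1, i)"
    using T by (auto simp: second_difference_mat_def)
  consider "i = q" | "q = i + 1" | "i = q + 1" | "i + 1 < q \<or> q + 1 < i" by linarith
  then show ?thesis
  proof cases
    case 2 then show ?thesis using off[of i] assms by auto
  next
    case 3 then show ?thesis using off[of q] assms by auto
  next
    case 4
    then have "T $$ (i, q) = 0" "T $$ (q, i) = 0"
      using tri TC assms(2,3) unfolding tridiagonal_def by auto
    then show ?thesis by simp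
  qed simp
qed

lemma first_difference_row:
  assumes B: "first_difference_mat n h B" and i: "i \<in> {1..n - 1}"
  shows "(\<Sum>q<n + 1. B $$ (i, q) * f q) = (f (i + 1) - f (i - 1)) / (2 * h)"
proof -
  have BC: "B \<in> carrier_mat (n + 1) (n + 1)" and tri: "tridiagonal B"
    and e: "B $$ (i, i - 1) = - 1 / (2 * h)" "B $$ (i, i) = 0" "B $$ (i, i + 1) = 1 / (2 * h)"
    using B i by (auto simp: first_difference_mat_def)
  show ?thesis
    unfolding tridiagonal_sum[OF BC tri i] e by (simp add: diff_divide_distrib)
qed

lemma mat_diag_row:
  fixes f :: "nat \<Rightarrow> real"
  assumes "k < m"
  shows "(\<Sum>q<m. mat_diag m d $$ (k, q) * f q) = d k * f k"
proof -
  have "(\<Sum>q<m. mat_diag m d $$ (k, q) * f q) = (\<Sum>q<m. if q = k then d k * f k else 0)"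
    using assms by (intro sum.cong refl) (auto simp: mat_diag_def)
  then show ?thesis using assms by simp
qed

lemma mat_diag_mult_row:
  fixes f :: "nat \<Rightarrow> real"
  assumes "k < m" "A \<in> carrier_mat m m"
  shows "(\<Sum>q<m. (mat_diag m d * A) $$ (k, q) * f q) = d k * (\<Sum>q<m. A $$ (k, q) * f q)"
  unfolding sum_distrib_left
  by (intro sum.cong refl) (use assms in \<open>auto simp: mat_diag_mult_left\<close>)

section \<open>Linearity\<close>

lemma mult_mat_lincomb_right:
  fixes A :: "'a::comm_ring_1 mat"
  assumes A: "A \<in> carrier_mat m c" and X: "X \<in> carrier_mat c d" and Y: "Y \<in> carrier_mat c d"
  shows "A * (a \<cdot>\<^sub>m X + b \<cdot>\<^sub>m Y) = a \<cdot>\<^sub>m (A * X) + b \<cdot>\<^sub>m (A * Y)"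
proof -
  have "A * (a \<cdot>\<^sub>m X + b \<cdot>\<^sub>m Y) = A * (a \<cdot>\<^sub>m X) + A * (b \<cdot>\<^sub>m Y)"
    by (rule mult_add_distrib_mat[OF A]) (use X Y in auto)
  then show ?thesis by (simp add: mult_smult_distrib[OF A X] mult_smult_distrib[OF A Y])
qed

lemma mult_mat_lincomb_left:
  fixes C :: "'a::comm_ring_1 mat"
  assumes X: "X \<in> carrier_mat m c" and Y: "Y \<in> carrier_mat m c" and C: "C \<in> carrier_mat c d"
  shows "(a \<cdot>\<^sub>m X + b \<cdot>\<^sub>m Y) * C = a \<cdot>\<^sub>m (X * C) + b \<cdot>\<^sub>m (Y * C)"
proof -
  have "(a \<cdot>\<^sub>m X + b \<cdot>\<^sub>m Y) * C = (a \<cdot>\<^sub>m X) * C + (b \<cdot>\<^sub>m Y) * C"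
    by (rule add_mult_distrib_mat[OF _ _ C]) (use X Y in auto)
  then show ?thesis by (simp add: mult_smult_assoc_mat[OF X C] mult_smult_assoc_mat[OF Y C])
qed

lemma
  assumes M: "T \<in> carrier_mat (n + 1) (n + 1)" "B \<in> carrier_mat (n + 1) (n + 1)"
    "\<And>l. l \<in> {1,2,3} \<Longrightarrow> \<Phi> l \<in> carrier_mat (n + 1) (n + 1)"
    "\<And>l. l \<in> {1,2,3} \<Longrightarrow> \<Psi> l \<in> carrier_mat (n + 1) (n + 1)"
    "\<And>l. l \<in> {1,2,3} \<Longrightarrow> \<Upsilon> l \<in> carrier_mat (n + 1) (n + 1)"
    and X: "X \<in> carrier_mat ((n + 1)^2) (n + 1)"
  shows conv_diff_op_carrier:
      "conv_diff_op n \<epsilon> T B \<Phi> \<Psi> \<Upsilon> X \<in> carrier_mat ((n + 1)^2) (n + 1)"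
    and conv_diff_op_linear: "Y \<in> carrier_mat ((n + 1)^2) (n + 1) \<Longrightarrow>
      conv_diff_op n \<epsilon> T B \<Phi> \<Psi> \<Upsilon> (a \<cdot>\<^sub>m X + b \<cdot>\<^sub>m Y)
        = a \<cdot>\<^sub>m conv_diff_op n \<epsilon> T B \<Phi> \<Psi> \<Upsilon> X + b \<cdot>\<^sub>m conv_diff_op n \<epsilon> T B \<Phi> \<Psi> \<Upsilon> Y"
proof -
  define N M where "N = n + 1" and "M = N^2"
  define K1 K3 K4 K5 K6 where K_def: "K1 = 1\<^sub>m (n + 1) \<otimes>\<^sub>K T" "K3 = T \<otimes>\<^sub>K 1\<^sub>m (n + 1)"
    "K4 = \<Upsilon> 1 \<otimes>\<^sub>K (\<Phi> 1 * B)" "K5 = \<Upsilon> 2 \<otimes>\<^sub>K \<Phi> 2" "K6 = (\<Upsilon> 3 * B) \<otimes>\<^sub>K \<Phi> 3"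
  note op = conv_diff_op_def[of n \<epsilon> T B \<Phi> \<Psi> \<Upsilon>, folded K_def]
  have kron: "A \<otimes>\<^sub>K C \<in> carrier_mat M M"
    if "A \<in> carrier_mat N N" "C \<in> carrier_mat N N" for A C :: "real mat"
    using that by (intro carrier_matI) (auto simp: N_def M_def power2_eq_square)
  have right: "T \<in> carrier_mat N N" "transpose_mat B \<in> carrier_mat N N"
    "\<Psi> 1 \<in> carrier_mat N N" "\<Psi> 2 \<in> carrier_mat N N" "\<Psi> 3 \<in> carrier_mat N N"
    using M by (auto simp: N_def)
  have left: "K1 \<in> carrier_mat M M" "K3 \<in> carrier_mat M M" "K4 \<in> carrier_mat M M"
    "K5 \<in> carrier_mat M M" "K6 \<in> carrier_mat M M"
    unfolding K_def using M by (auto simp: N_def intro!: kron mult_carrier_mat)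
  note mults = mult_carrier_mat[of _ M M _ N] mult_carrier_mat[of _ M N _ N]
  have X': "X \<in> carrier_mat M N" using X by (simp add: M_def N_def)
  show "conv_diff_op n \<epsilon> T B \<Phi> \<Psi> \<Upsilon> X \<in> carrier_mat ((n + 1)^2) (n + 1)"
    unfolding op N_def[symmetric] unfolding M_def[symmetric]
    by (simp only: add_carrier_mat smult_carrier_mat mults X' left right)
  assume "Y \<in> carrier_mat ((n + 1)^2) (n + 1)"
  then have Y': "Y \<in> carrier_mat M N" by (simp add: M_def N_def)
  have plus: "(a \<cdot>\<^sub>m P + b \<cdot>\<^sub>m Q) + (a \<cdot>\<^sub>m P' + b \<cdot>\<^sub>m Q') = a \<cdot>\<^sub>m (P + P') + b \<cdot>\<^sub>m (Q + Q')"
    if "P \<in> carrier_mat M N" "Q \<in> carrier_mat M N" "P' \<in> carrier_mat M N" "Q' \<in> carrier_mat M N"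
    for P P' Q Q' :: "real mat"
    using that by (intro eq_matI) (auto simp: distrib_left)
  have scale: "\<epsilon> \<cdot>\<^sub>m (a \<cdot>\<^sub>m P + b \<cdot>\<^sub>m Q) = a \<cdot>\<^sub>m (\<epsilon> \<cdot>\<^sub>m P) + b \<cdot>\<^sub>m (\<epsilon> \<cdot>\<^sub>m Q)"
    if "P \<in> carrier_mat M N" "Q \<in> carrier_mat M N" for P Q :: "real mat"
    using that by (intro eq_matI) (auto simp: distrib_left)
  have L: "P * (a \<cdot>\<^sub>m X + b \<cdot>\<^sub>m Y) = a \<cdot>\<^sub>m (P * X) + b \<cdot>\<^sub>m (P * Y)"
    if "P \<in> carrier_mat M M" for P
    by (rule mult_mat_lincomb_right[OF that X' Y'])
  have R: "(a \<cdot>\<^sub>m V + b \<cdot>\<^sub>m W) * C = a \<cdot>\<^sub>m (V * C) + b \<cdot>\<^sub>m (W * C)"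
    if "C \<in> carrier_mat N N" "V \<in> carrier_mat M N" "W \<in> carrier_mat M N" for C V W :: "real mat"
    using that by (intro mult_mat_lincomb_left)
  show "conv_diff_op n \<epsilon> T B \<Phi> \<Psi> \<Upsilon> (a \<cdot>\<^sub>m X + b \<cdot>\<^sub>m Y)
      = a \<cdot>\<^sub>m conv_diff_op n \<epsilon> T B \<Phi> \<Psi> \<Upsilon> X + b \<cdot>\<^sub>m conv_diff_op n \<epsilon> T B \<Phi> \<Psi> \<Upsilon> Y"
    unfolding op by (simp only: L R plus scale mults X' Y' left right add_carrier_mat smult_carrier_mat)
qed

section \<open>The operator at an interior node\<close>

text \<open>
  With arbitrary diagonal entries \<open>p\<close>, \<open>q\<close>, \<open>r\<close> this is a pure matrix computation. Separability
  enters afterwards, when the product \<open>p l i * q l j * r l k\<close> is recognised as the value of the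
  \<open>l\<close>-th convection component at a node.
\<close>

lemma conv_diff_op_interior:
  assumes T: "second_difference_mat n h T" and B: "first_difference_mat n h B"
    and Phi: "\<And>l. l \<in> {1,2,3} \<Longrightarrow> \<Phi> l = mat_diag (n + 1) (p l)"
    and Psi: "\<And>l. l \<in> {1,2,3} \<Longrightarrow> \<Psi> l = mat_diag (n + 1) (q l)"
    and Upsilon: "\<And>l. l \<in> {1,2,3} \<Longrightarrow> \<Upsilon> l = mat_diag (n + 1) (r l)"
    and U: "\<And>k. k \<le> n \<Longrightarrow> U k \<in> carrier_mat (n + 1) (n + 1)"
    and i: "i \<in> {1..n - 1}" and j: "j \<in> {1..n - 1}" and k: "k \<in> {1..n - 1}"
  shows "conv_diff_op n \<epsilon> T B \<Phi> \<Psi> \<Upsilon> (stack n U) $$ (k * (n + 1) + i, j) =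
      - (\<epsilon> / h^2) *
         ((U k $$ (i - 1, j) - 2 * U k $$ (i, j) + U k $$ (i + 1, j))
        + (U k $$ (i, j - 1) - 2 * U k $$ (i, j) + U k $$ (i, j + 1))
        + (U (k - 1) $$ (i, j) - 2 * U k $$ (i, j) + U (k + 1) $$ (i, j)))
      + p 1 i * q 1 j * r 1 k * ((U k $$ (i + 1, j) - U k $$ (i - 1, j)) / (2 * h))
      + p 2 i * q 2 j * r 2 k * ((U k $$ (i, j + 1) - U k $$ (i, j - 1)) / (2 * h))
      + p 3 i * q 3 j * r 3 k * ((U (k + 1) $$ (i, j) - U (k - 1) $$ (i, j)) / (2 * h))"
proof -
  define N X where "N = n + 1" and "X = stack n U"
  have i': "i < N" "i \<le> n" and j': "j < N" "j \<le> n" and k': "k < N" "k \<le> n"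
    using i j k by (auto simp: N_def)
  have TC: "T \<in> carrier_mat N N" and BC: "B \<in> carrier_mat N N"
    using T B by (simp_all add: second_difference_mat_def first_difference_mat_def N_def)
  have DC: "\<And>l. l \<in> {1,2,3} \<Longrightarrow> \<Phi> l \<in> carrier_mat N N"
    "\<And>l. l \<in> {1,2,3} \<Longrightarrow> \<Psi> l \<in> carrier_mat N N"
    "\<And>l. l \<in> {1,2,3} \<Longrightarrow> \<Upsilon> l \<in> carrier_mat N N"
    by (simp_all add: Phi Psi Upsilon N_def)
  have XC: "X \<in> carrier_mat (N * N) N"
    unfolding X_def N_def by (rule stack_carrier[OF U])
  have Xi: "X $$ (c * N + a, b) = U c $$ (a, b)" if "a < N" "b < N" "c < N" for a b c
    unfolding X_def N_def by (rule stack_index[OF U]) (use that in \<open>auto simp: N_def\<close>)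
  have kron: "A \<otimes>\<^sub>K C \<in> carrier_mat (N * N) (N * N)"
    if "A \<in> carrier_mat N N" "C \<in> carrier_mat N N" for A C :: "real mat"
    using that by (intro carrier_matI) auto
  have s: "k * N + i < N * N" by (rule block_row_less[OF k'(1) i'(1)])
  have entry: "((A \<otimes>\<^sub>K C) * X) $$ (k * N + i, b)
      = (\<Sum>c<N. A $$ (k, c) * (\<Sum>a<N. C $$ (i, a) * U c $$ (a, b)))"
    if "A \<in> carrier_mat N N" "C \<in> carrier_mat N N" "b < N" for A C b
    unfolding kronecker_mult_index[OF that(1,2) XC k'(1) i'(1) that(3)]
    using that(3) by (intro sum.cong refl arg_cong2[where f = "(*)"]) (simp_all add: Xi)
  have diag_right: "(Z * \<Psi> l) $$ (k * N + i, j) = Z $$ (k * N + i, j) * q l j"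
    if "Z \<in> carrier_mat (N * N) N" "l \<in> {1,2,3}" for Z l
    using that s j' by (simp add: Psi N_def mat_diag_mult_right[of _ "N * N"])
  have one: "(\<Sum>c<N. 1\<^sub>m N $$ (a, c) * f c) = f a" if "a < N" for a and f :: "nat \<Rightarrow> real"
    using mat_diag_row[OF that, of "\<lambda>_. 1" f] by simp
  note Trow = second_difference_row[OF T, folded N_def]
  note Brow = first_difference_row[OF B, folded N_def]
  have t1: "((1\<^sub>m N \<otimes>\<^sub>K T) * X) $$ (k * N + i, j)
      = - (U k $$ (i - 1, j) - 2 * U k $$ (i, j) + U k $$ (i + 1, j)) / h^2"
    unfolding entry[OF one_carrier_mat TC j'(1)] one[OF k'(1)] by (rule Trow[OF i])
  \<comment> \<open>Multiplication from the right uses column \<open>j\<close> of \<open>T\<close>, which equals its row \<open>j\<close>.\<close>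
  have "(X * T) $$ (k * N + i, j) = (\<Sum>b<N. T $$ (j, b) * U k $$ (i, b))"
    unfolding mult_mat_index_sum[OF XC TC s j'(1)]
  proof (intro sum.cong refl)
    fix b assume "b \<in> {..<N}"
    then have b: "b < N" "b \<le> n" by (auto simp: N_def)
    show "X $$ (k * N + i, b) * T $$ (b, j) = T $$ (j, b) * U k $$ (i, b)"
      unfolding Xi[OF i'(1) b(1) k'(1)] second_difference_symmetric[OF T b(2) j'(2)]
      by (rule mult.commute)
  qed
  then have t2: "(X * T) $$ (k * N + i, j)
      = - (U k $$ (i, j - 1) - 2 * U k $$ (i, j) + U k $$ (i, j + 1)) / h^2"
    by (simp add: Trow[OF j])
  have t3: "((T \<otimes>\<^sub>K 1\<^sub>m N) * X) $$ (k * N + i, j)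
      = - (U (k - 1) $$ (i, j) - 2 * U k $$ (i, j) + U (k + 1) $$ (i, j)) / h^2"
    unfolding entry[OF TC one_carrier_mat j'(1)] one[OF i'(1)] by (rule Trow[OF k])
  have Upsilon_row: "(\<Sum>c<N. \<Upsilon> l $$ (k, c) * f c) = r l k * f k" if "l \<in> {1,2,3}" for l f
    unfolding Upsilon[OF that] N_def[symmetric] by (rule mat_diag_row[OF k'(1)])
  have Phi_row: "(\<Sum>a<N. \<Phi> l $$ (i, a) * f a) = p l i * f i" if "l \<in> {1,2,3}" for l f
    unfolding Phi[OF that] N_def[symmetric] by (rule mat_diag_row[OF i'(1)])
  have PhiB_row: "(\<Sum>a<N. (\<Phi> 1 * B) $$ (i, a) * f a) = p 1 i * ((f (i + 1) - f (i - 1)) / (2 * h))" for f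
    using mat_diag_mult_row[OF i'(1) BC, of "p 1" f]
    by (simp only: Phi insert_iff simp_thms N_def[symmetric] Brow[OF i])
  have UpsilonB_row: "(\<Sum>c<N. (\<Upsilon> 3 * B) $$ (k, c) * f c) = r 3 k * ((f (k + 1) - f (k - 1)) / (2 * h))" for f
    using mat_diag_mult_row[OF k'(1) BC, of "r 3" f]
    by (simp only: Upsilon insert_iff simp_thms N_def[symmetric] Brow[OF k])
  have PB: "\<Phi> 1 * B \<in> carrier_mat N N" and UB: "\<Upsilon> 3 * B \<in> carrier_mat N N"
    by (rule mult_carrier_mat[OF DC(1) BC] mult_carrier_mat[OF DC(3) BC]; simp)+
  have t4: "((\<Upsilon> 1 \<otimes>\<^sub>K (\<Phi> 1 * B)) * X * \<Psi> 1) $$ (k * N + i, j)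
      = r 1 k * (p 1 i * ((U k $$ (i + 1, j) - U k $$ (i - 1, j)) / (2 * h))) * q 1 j"
  proof -
    have "(\<Upsilon> 1 \<otimes>\<^sub>K (\<Phi> 1 * B)) * X \<in> carrier_mat (N * N) N"
      by (rule mult_carrier_mat[OF kron XC]) (use DC PB in auto)
    from diag_right[OF this, of 1] show ?thesis
      using entry[OF DC(3)[of 1] PB j'(1)] by (simp only: Upsilon_row PhiB_row insert_iff simp_thms)
  qed
  have t5: "((\<Upsilon> 2 \<otimes>\<^sub>K \<Phi> 2) * X * transpose_mat B * \<Psi> 2) $$ (k * N + i, j)
      = r 2 k * (p 2 i * ((U k $$ (i, j + 1) - U k $$ (i, j - 1)) / (2 * h))) * q 2 j"
  proof -
    have KX: "(\<Upsilon> 2 \<otimes>\<^sub>K \<Phi> 2) * X \<in> carrier_mat (N * N) N"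
      by (rule mult_carrier_mat[OF kron XC]) (use DC in auto)
    have BT: "transpose_mat B \<in> carrier_mat N N" using BC by simp
    have "((\<Upsilon> 2 \<otimes>\<^sub>K \<Phi> 2) * X * transpose_mat B) $$ (k * N + i, j)
        = (\<Sum>b<N. r 2 k * p 2 i * (B $$ (j, b) * U k $$ (i, b)))"
      unfolding mult_mat_index_sum[OF KX BT s j'(1)]
    proof (intro sum.cong refl)
      fix b assume "b \<in> {..<N}"
      then have b: "b < N" by simp
      have "((\<Upsilon> 2 \<otimes>\<^sub>K \<Phi> 2) * X) $$ (k * N + i, b) = r 2 k * (p 2 i * U k $$ (i, b))"
        using entry[OF DC(3)[of 2] DC(1)[of 2] b] by (simp only: Upsilon_row Phi_row insert_iff simp_thms)
      moreover have "transpose_mat B $$ (b, j) = B $$ (j, b)" using BC b j' by simp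
      ultimately show "((\<Upsilon> 2 \<otimes>\<^sub>K \<Phi> 2) * X) $$ (k * N + i, b) * transpose_mat B $$ (b, j)
          = r 2 k * p 2 i * (B $$ (j, b) * U k $$ (i, b))"
        by (simp only: mult_ac)
    qed
    also have "\<dots> = r 2 k * p 2 i * ((U k $$ (i, j + 1) - U k $$ (i, j - 1)) / (2 * h))"
      by (simp only: sum_distrib_left[symmetric] Brow[OF j])
    finally show ?thesis
      using diag_right[OF mult_carrier_mat[OF KX BT], of 2] by (simp only: insert_iff simp_thms mult.assoc)
  qed
  have t6: "(((\<Upsilon> 3 * B) \<otimes>\<^sub>K \<Phi> 3) * X * \<Psi> 3) $$ (k * N + i, j)
      = r 3 k * (p 3 i * ((U (k + 1) $$ (i, j) - U (k - 1) $$ (i, j)) / (2 * h))) * q 3 j"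
  proof -
    have "((\<Upsilon> 3 * B) \<otimes>\<^sub>K \<Phi> 3) * X \<in> carrier_mat (N * N) N"
      by (rule mult_carrier_mat[OF kron XC]) (use DC UB in auto)
    from diag_right[OF this, of 3] show ?thesis
      using entry[OF UB DC(1)[of 3] j'(1)] by (simp only: UpsilonB_row Phi_row insert_iff simp_thms right_diff_distrib[symmetric] times_divide_eq_right)
  qed
  have add: "(P + Q) $$ (k * N + i, j) = P $$ (k * N + i, j) + Q $$ (k * N + i, j)"
    if "dim_row Q = N * N" "dim_col Q = N" for P Q :: "real mat"
    using that s j' by simp
  have smult: "(\<epsilon> \<cdot>\<^sub>m P) $$ (k * N + i, j) = \<epsilon> * P $$ (k * N + i, j)"
    if "dim_row P = N * N" "dim_col P = N" for P :: "real mat"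
    using that s j' by simp
  have regroup: "\<epsilon> * (- d1 / H) + \<epsilon> * (- d2 / H) + \<epsilon> * (- d3 / H)
        + r1 * (p1 * g1) * q1 + r2 * (p2 * g2) * q2 + r3 * (p3 * g3) * q3
      = - (\<epsilon> / H) * (d1 + d2 + d3) + p1 * q1 * r1 * g1 + p2 * q2 * r2 * g2 + p3 * q3 * r3 * g3"
    for d1 d2 d3 H r1 r2 r3 p1 p2 p3 q1 q2 q3 g1 g2 g3 :: real
    by (simp add: algebra_simps add_divide_distrib)
  have dims: "dim_row X = N * N" "dim_col X = N" "dim_row T = N" "dim_col T = N"
    "dim_row B = N" "dim_col B = N"
    "\<And>l. l \<in> {1,2,3} \<Longrightarrow> dim_row (\<Phi> l) = N" "\<And>l. l \<in> {1,2,3} \<Longrightarrow> dim_row (\<Upsilon> l) = N"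
    "\<And>l. l \<in> {1,2,3} \<Longrightarrow> dim_col (\<Psi> l) = N"
    using XC TC BC DC by blast+
  have "conv_diff_op n \<epsilon> T B \<Phi> \<Psi> \<Upsilon> X $$ (k * N + i, j) =
      \<epsilon> * ((1\<^sub>m N \<otimes>\<^sub>K T) * X) $$ (k * N + i, j) + \<epsilon> * (X * T) $$ (k * N + i, j)
      + \<epsilon> * ((T \<otimes>\<^sub>K 1\<^sub>m N) * X) $$ (k * N + i, j)
      + ((\<Upsilon> 1 \<otimes>\<^sub>K (\<Phi> 1 * B)) * X * \<Psi> 1) $$ (k * N + i, j)
      + ((\<Upsilon> 2 \<otimes>\<^sub>K \<Phi> 2) * X * transpose_mat B * \<Psi> 2) $$ (k * N + i, j)
      + (((\<Upsilon> 3 * B) \<otimes>\<^sub>K \<Phi> 3) * X * \<Psi> 3) $$ (k * N + i, j)"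
    unfolding conv_diff_op_def N_def[symmetric]
    by (simp only: add smult dims dim_kronecker index_mult_mat(2,3) index_smult_mat(2,3)
        index_one_mat(2,3) insert_iff simp_thms)
  also have "\<dots> = - (\<epsilon> / h^2) *
         ((U k $$ (i - 1, j) - 2 * U k $$ (i, j) + U k $$ (i + 1, j))
        + (U k $$ (i, j - 1) - 2 * U k $$ (i, j) + U k $$ (i, j + 1))
        + (U (k - 1) $$ (i, j) - 2 * U k $$ (i, j) + U (k + 1) $$ (i, j)))
      + p 1 i * q 1 j * r 1 k * ((U k $$ (i + 1, j) - U k $$ (i - 1, j)) / (2 * h))
      + p 2 i * q 2 j * r 2 k * ((U k $$ (i, j + 1) - U k $$ (i, j - 1)) / (2 * h))
      + p 3 i * q 3 j * r 3 k * ((U (k + 1) $$ (i, j) - U (k - 1) $$ (i, j)) / (2 * h))"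
    unfolding t1 t2 t3 t4 t5 t6 by (rule regroup)
  finally show ?thesis unfolding N_def X_def .
qed

theorem proposition5p1:
  fixes n :: nat and h \<epsilon> :: real
    and x y z :: "nat \<Rightarrow> real"
    and w :: "nat \<Rightarrow> real \<Rightarrow> real \<Rightarrow> real \<Rightarrow> real"
    and \<phi> \<psi> \<upsilon> :: "nat \<Rightarrow> real \<Rightarrow> real"
    and \<Phi> \<Psi> \<Upsilon> :: "nat \<Rightarrow> real mat"
    and T B :: "real mat"
  assumes n: "n \<ge> 2" and h: "h = 1 / real n" and eps: "\<epsilon> > 0"
    and nodes: "\<forall>i\<in>{0..n}. x i = real i * h \<and> y i = real i * h \<and> z i = real i * h"
    and separable: "\<forall>l\<in>{1,2,3}. \<forall>s\<in>{0..1}. \<forall>t\<in>{0..1}. \<forall>r\<in>{0..1}.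
      w l s t r = \<phi> l s * \<psi> l t * \<upsilon> l r"
    and Phi: "\<forall>l\<in>{1,2,3}. \<Phi> l = mat_diag (n + 1) (\<lambda>i. \<phi> l (x i))"
    and Psi: "\<forall>l\<in>{1,2,3}. \<Psi> l = mat_diag (n + 1) (\<lambda>j. \<psi> l (y j))"
    and Upsilon: "\<forall>l\<in>{1,2,3}. \<Upsilon> l = mat_diag (n + 1) (\<lambda>k. \<upsilon> l (z k))"
    and T: "second_difference_mat n h T"
    and B: "first_difference_mat n h B"
  shows
    "(\<forall>X \<in> carrier_mat ((n + 1)^2) (n + 1).
        conv_diff_op n \<epsilon> T B \<Phi> \<Psi> \<Upsilon> X \<in> carrier_mat ((n + 1)^2) (n + 1)) \<and>
     (\<forall>X \<in> carrier_mat ((n + 1)^2) (n + 1). \<forall>Y \<in> carrier_mat ((n + 1)^2) (n + 1). \<forall>a b.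
        conv_diff_op n \<epsilon> T B \<Phi> \<Psi> \<Upsilon> (a \<cdot>\<^sub>m X + b \<cdot>\<^sub>m Y) =
          a \<cdot>\<^sub>m conv_diff_op n \<epsilon> T B \<Phi> \<Psi> \<Upsilon> X + b \<cdot>\<^sub>m conv_diff_op n \<epsilon> T B \<Phi> \<Psi> \<Upsilon> Y) \<and>
     (\<forall>U. (\<forall>k\<in>{0..n}. U k \<in> carrier_mat (n + 1) (n + 1)) \<longrightarrow>
        (\<exists>L. (\<forall>k\<in>{0..n}. L k \<in> carrier_mat (n + 1) (n + 1)) \<and>
           conv_diff_op n \<epsilon> T B \<Phi> \<Psi> \<Upsilon> (stack n U) = stack n L) \<and>
        (\<forall>L. (\<forall>k\<in>{0..n}. L k \<in> carrier_mat (n + 1) (n + 1)) \<and>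
           conv_diff_op n \<epsilon> T B \<Phi> \<Psi> \<Upsilon> (stack n U) = stack n L \<longrightarrow>
           (\<forall>i\<in>{1..n - 1}. \<forall>j\<in>{1..n - 1}. \<forall>k\<in>{1..n - 1}.
              L k $$ (i, j) =
                - (\<epsilon> / h^2) *
                   ((U k $$ (i - 1, j) - 2 * U k $$ (i, j) + U k $$ (i + 1, j))
                  + (U k $$ (i, j - 1) - 2 * U k $$ (i, j) + U k $$ (i, j + 1))
                  + (U (k - 1) $$ (i, j) - 2 * U k $$ (i, j) + U (k + 1) $$ (i, j)))
                + w 1 (x i) (y j) (z k) * ((U k $$ (i + 1, j) - U k $$ (i - 1, j)) / (2 * h))
                + w 2 (x i) (y j) (z k) * ((U k $$ (i, j + 1) - U k $$ (i, j - 1)) / (2 * h))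
                + w 3 (x i) (y j) (z k) * ((U (k + 1) $$ (i, j) - U (k - 1) $$ (i, j)) / (2 * h)))))"
proof -
  define F where "F = conv_diff_op n \<epsilon> T B \<Phi> \<Psi> \<Upsilon>"
  have M: "T \<in> carrier_mat (n + 1) (n + 1)" "B \<in> carrier_mat (n + 1) (n + 1)"
    "\<And>l. l \<in> {1,2,3} \<Longrightarrow> \<Phi> l \<in> carrier_mat (n + 1) (n + 1)"
    "\<And>l. l \<in> {1,2,3} \<Longrightarrow> \<Psi> l \<in> carrier_mat (n + 1) (n + 1)"
    "\<And>l. l \<in> {1,2,3} \<Longrightarrow> \<Upsilon> l \<in> carrier_mat (n + 1) (n + 1)"
    using T B Phi Psi Upsilon by (auto simp: second_difference_mat_def first_difference_mat_def)
  have carrier: "F X \<in> carrier_mat ((n + 1)^2) (n + 1)"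
    if "X \<in> carrier_mat ((n + 1)^2) (n + 1)" for X
    unfolding F_def by (rule conv_diff_op_carrier[OF M that])
  have linear: "F (a \<cdot>\<^sub>m X + b \<cdot>\<^sub>m Y) = a \<cdot>\<^sub>m F X + b \<cdot>\<^sub>m F Y"
    if "X \<in> carrier_mat ((n + 1)^2) (n + 1)" "Y \<in> carrier_mat ((n + 1)^2) (n + 1)" for X Y a b
    unfolding F_def by (rule conv_diff_op_linear[OF M that])
  have range: "\<exists>L. (\<forall>k\<in>{0..n}. L k \<in> carrier_mat (n + 1) (n + 1)) \<and> F (stack n U) = stack n L"
    if "\<forall>k\<in>{0..n}. U k \<in> carrier_mat (n + 1) (n + 1)" for U
  proof (rule stack_surj)
    have "stack n U \<in> carrier_mat ((n + 1)^2) (n + 1)"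
      unfolding power2_eq_square by (rule stack_carrier) (use that in simp)
    from carrier[OF this] show "F (stack n U) \<in> carrier_mat ((n + 1) * (n + 1)) (n + 1)"
      unfolding power2_eq_square .
  qed
  have node: "x i \<in> {0..1}" "y i \<in> {0..1}" "z i \<in> {0..1}" if "i \<le> n" for i
    using nodes n h that by auto
  have w: "w l (x i) (y j) (z k) = \<phi> l (x i) * \<psi> l (y j) * \<upsilon> l (z k)"
    if "l \<in> {1,2,3}" "i \<in> {1..n - 1}" "j \<in> {1..n - 1}" "k \<in> {1..n - 1}" for l i j k
  proof -
    have "i \<le> n" "j \<le> n" "k \<le> n" using that(2-4) by auto
    then have "x i \<in> {0..1}" "y j \<in> {0..1}" "z k \<in> {0..1}" by (simp_all only: node)
    with separable that(1) show ?thesis by blast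
  qed
  have interior: "L k $$ (i, j) =
        - (\<epsilon> / h^2) *
           ((U k $$ (i - 1, j) - 2 * U k $$ (i, j) + U k $$ (i + 1, j))
          + (U k $$ (i, j - 1) - 2 * U k $$ (i, j) + U k $$ (i, j + 1))
          + (U (k - 1) $$ (i, j) - 2 * U k $$ (i, j) + U (k + 1) $$ (i, j)))
        + w 1 (x i) (y j) (z k) * ((U k $$ (i + 1, j) - U k $$ (i - 1, j)) / (2 * h))
        + w 2 (x i) (y j) (z k) * ((U k $$ (i, j + 1) - U k $$ (i, j - 1)) / (2 * h))
        + w 3 (x i) (y j) (z k) * ((U (k + 1) $$ (i, j) - U (k - 1) $$ (i, j)) / (2 * h))"
    if U: "\<forall>k\<in>{0..n}. U k \<in> carrier_mat (n + 1) (n + 1)"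
      and L: "\<forall>k\<in>{0..n}. L k \<in> carrier_mat (n + 1) (n + 1)" and eq: "F (stack n U) = stack n L"
      and i: "i \<in> {1..n - 1}" and j: "j \<in> {1..n - 1}" and k: "k \<in> {1..n - 1}" for U L i j k
  proof -
    have "L k $$ (i, j) = F (stack n U) $$ (k * (n + 1) + i, j)"
      unfolding eq by (rule stack_index[symmetric]) (use L i j k in auto)
    also have "\<dots> = - (\<epsilon> / h^2) *
           ((U k $$ (i - 1, j) - 2 * U k $$ (i, j) + U k $$ (i + 1, j))
          + (U k $$ (i, j - 1) - 2 * U k $$ (i, j) + U k $$ (i, j + 1))
          + (U (k - 1) $$ (i, j) - 2 * U k $$ (i, j) + U (k + 1) $$ (i, j)))
        + \<phi> 1 (x i) * \<psi> 1 (y j) * \<upsilon> 1 (z k) * ((U k $$ (i + 1, j) - U k $$ (i - 1, j)) / (2 * h))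
        + \<phi> 2 (x i) * \<psi> 2 (y j) * \<upsilon> 2 (z k) * ((U k $$ (i, j + 1) - U k $$ (i, j - 1)) / (2 * h))
        + \<phi> 3 (x i) * \<psi> 3 (y j) * \<upsilon> 3 (z k) * ((U (k + 1) $$ (i, j) - U (k - 1) $$ (i, j)) / (2 * h))"
      unfolding F_def using Phi Psi Upsilon U
      by (intro conv_diff_op_interior[OF T B _ _ _ _ i j k]) auto
    finally show ?thesis
      by (simp only: w[OF _ i j k] insert_iff simp_thms)
  qed
  show ?thesis
    unfolding F_def[symmetric]
  proof (intro conjI ballI allI impI)
    fix U L i j k
    assume "\<forall>k\<in>{0..n}. U k \<in> carrier_mat (n + 1) (n + 1)"
      and "(\<forall>k\<in>{0..n}. L k \<in> carrier_mat (n + 1) (n + 1)) \<and> F (stack n U) = stack n L"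
      and "i \<in> {1..n - 1}" "j \<in> {1..n - 1}" "k \<in> {1..n - 1}"
    then show "L k $$ (i, j) =
        - (\<epsilon> / h^2) *
           ((U k $$ (i - 1, j) - 2 * U k $$ (i, j) + U k $$ (i + 1, j))
          + (U k $$ (i, j - 1) - 2 * U k $$ (i, j) + U k $$ (i, j + 1))
          + (U (k - 1) $$ (i, j) - 2 * U k $$ (i, j) + U (k + 1) $$ (i, j)))
        + w 1 (x i) (y j) (z k) * ((U k $$ (i + 1, j) - U k $$ (i - 1, j)) / (2 * h))
        + w 2 (x i) (y j) (z k) * ((U k $$ (i, j + 1) - U k $$ (i, j - 1)) / (2 * h))
        + w 3 (x i) (y j) (z k) * ((U (k + 1) $$ (i, j) - U (k - 1) $$ (i, j)) / (2 * h))"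
      by (elim conjE) (rule interior)
  qed (fact carrier linear range)+
qed

end
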